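(* Let $\lambda>-1/2$ and $z>0$, and let $\mathbf{s}$ be the linear functional on polynomials defined by $\langle \mathbf{s},p\rangle=\int_{-1}^{1}p(x)(1-x^2)^{\lambda-1/2}e^{-zx^2}\,dx$. Then $\mathbf{s}$ is semiclassical of class $2$. Moreover, $\mathbf{s}$ satisfies the Pearson equation $$D(\phi\,\mathbf{s})+\psi\,\mathbf{s}=0,$$ with $\phi(x)=1-x^2$ and $\psi(x)=(2z+2\lambda+1)x-2zx^3$.
   Context: Let $\mathbb{P}$ be the space of polynomials with complex coefficients. For a linear functional $\mathbf{u}:\mathbb{P}\to\mathbb{C}$ and $q\in\mathbb{P}$, the functional $q\,\mathbf{u}$ is defined by $\langle q\,\mathbf{u},p\rangle=\langle\mathbf{u},qp\rangle$, and $D\mathbf{u}$ is defined by $\langle D\mathbf{u},p\rangle=-\langle\mathbf{u},p'\rangle$. The functional $\mathbf{u}$ is quasi-definite if all leading principal submatrices of the Hankel matrix $(\langle\mathbf{u},x^{i+j}\rangle)_{i,j\ge0}$ are nonsingular. A quasi-definite $\mathbf{u}$ is semiclassical if there exist non-zero polynomials $\phi,\psi$ with $\deg\phi\ge0$ and $\deg\psi\ge1$ such that $D(\phi\,\mathbf{u})+\psi\,\mathbf{u}=0$. The class of a semiclassical functional $\mathbf{u}$ is $\min\max\{\deg\phi-2,\deg\psi-1\}$, the minimum being taken over all pairs $(\phi,\psi)$ of such polynomials for which $D(\phi\,\mathbf{u})+\psi\,\mathbf{u}=0$ holds. *)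

theory Defs
  imports "HOL-Analysis.Analysis" "Jordan_Normal_Form.Determinant"
begin

type_synonym functional = "complex poly \<Rightarrow> complex"

definition linear_functional :: "functional \<Rightarrow> bool" where
  "linear_functional u \<longleftrightarrow> Vector_Spaces.linear Polynomial.smult (*) u"

definition poly_times :: "complex poly \<Rightarrow> functional \<Rightarrow> functional" where
  "poly_times q u = (\<lambda>p. u (q * p))"

definition functional_deriv :: "functional \<Rightarrow> functional" where
  "functional_deriv u = (\<lambda>p. - u (pderiv p))"

definition hankel_mat :: "functional \<Rightarrow> nat \<Rightarrow> complex mat" where
  "hankel_mat u n = mat n n (\<lambda>(i, j). u (monom 1 (i + j)))"

text \<open>Both theories \<open>Determinants\<close> and \<open>Determinant\<close> provide a constant \<open>det\<close>; the one
  for matrices of variable size is meant.\<close>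

definition quasi_definite :: "functional \<Rightarrow> bool" where
  "quasi_definite u \<longleftrightarrow>
     linear_functional u \<and> (\<forall>n\<ge>1. Determinant.det (hankel_mat u n) \<noteq> 0)"

definition pearson_eq :: "functional \<Rightarrow> complex poly \<Rightarrow> complex poly \<Rightarrow> bool" where
  "pearson_eq u \<phi> \<psi> \<longleftrightarrow>
     (\<lambda>p. functional_deriv (poly_times \<phi> u) p + poly_times \<psi> u p) = (\<lambda>p. 0)"

text \<open>The condition \<open>deg \<phi> \<ge> 0\<close> only says \<open>\<phi> \<noteq> 0\<close>, since \<open>degree 0 = 0\<close> here.\<close>

definition pearson_pair :: "functional \<Rightarrow> complex poly \<Rightarrow> complex poly \<Rightarrow> bool" where
  "pearson_pair u \<phi> \<psi> \<longleftrightarrow>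
     \<phi> \<noteq> 0 \<and> \<psi> \<noteq> 0 \<and> degree \<psi> \<ge> 1 \<and> pearson_eq u \<phi> \<psi>"

definition semiclassical :: "functional \<Rightarrow> bool" where
  "semiclassical u \<longleftrightarrow> quasi_definite u \<and> (\<exists>\<phi> \<psi>. pearson_pair u \<phi> \<psi>)"

text \<open>The values are integers because \<open>deg \<phi> - 2\<close> may be negative. They are bounded below by
  \<open>0\<close>, so for a semiclassical functional the least one exists.\<close>

definition semiclassical_class :: "functional \<Rightarrow> int" where
  "semiclassical_class u =
     (LEAST m. \<exists>\<phi> \<psi>. pearson_pair u \<phi> \<psi> \<and>
        m = max (int (degree \<phi>) - 2) (int (degree \<psi>) - 1))"

end

theory Submission
  imports Defs
begin

text \<open>
  The Pearson equation is integration by parts for the weight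
  \<open>w = (1 - x\<^sup>2) powr a * exp (- z x\<^sup>2)\<close>, \<open>a = \<lambda> - 1/2\<close>; the boundary terms vanish because
  \<open>a + 1 > 0\<close>. Since \<open>w > 0\<close> inside the interval, \<open>s (p * cnj p) = 0\<close> forces \<open>p = 0\<close>. This gives
  quasi-definiteness, and it also shows that two Pearson pairs satisfy
  \<open>\<phi> (\<phi>\<^sub>1' + \<psi>\<^sub>1) = \<phi>\<^sub>1 (\<phi>' + \<psi>)\<close>. Any \<open>\<phi>\<^sub>1\<close> must vanish at \<open>\<plusminus>1\<close>: for \<open>a \<noteq> 0\<close> evaluate
  this identity there, whereas for \<open>a = 0\<close> the weight does not vanish at the end points and the
  boundary terms of the integration by parts give the claim. So \<open>\<phi>\<^sub>1 = \<phi> g\<close> and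
  \<open>\<phi>\<^sub>1' + \<psi>\<^sub>1 = g (\<phi>' + \<psi>)\<close>, where the right-hand side has degree \<open>deg g + 3\<close> and
  \<open>\<phi>\<^sub>1'\<close> has degree \<open>deg g + 1\<close>. Hence \<open>deg \<psi>\<^sub>1 \<ge> 3\<close>, so the class cannot be smaller than \<open>2\<close>.
\<close>

section \<open>The weight and its functional\<close>

text \<open>The exponent \<open>a\<close> stands for \<open>lam - 1 / 2\<close>. It is a parameter
  because integration by parts also uses the weight for \<open>a + 1\<close>.\<close>

definition gegenbauer_weight :: "real \<Rightarrow> real \<Rightarrow> real \<Rightarrow> real" where
  "gegenbauer_weight a z x = (1 - x\<^sup>2) powr a * exp (- z * x\<^sup>2)"

definition gegenbauer_functional :: "real \<Rightarrow> real \<Rightarrow> functional" where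
  "gegenbauer_functional a z p =
     (LINT x:{-1..1}|lborel. poly p (complex_of_real x) * complex_of_real (gegenbauer_weight a z x))"

section \<open>Linear functionals and quasi-definiteness\<close>

lemma linear_functional_simps:
  assumes "linear_functional u"
  shows "u (p + q) = u p + u q" "u (Polynomial.smult c p) = c * u p" "u (p - q) = u p - u q"
    "u (\<Sum>i\<in>A. f i) = (\<Sum>i\<in>A. u (f i))" "u 0 = 0"
proof -
  interpret Vector_Spaces.linear Polynomial.smult "(*)" u
    using assms by (simp add: linear_functional_def)
  show "u (p + q) = u p + u q" "u (Polynomial.smult c p) = c * u p" "u (p - q) = u p - u q"
    "u (\<Sum>i\<in>A. f i) = (\<Sum>i\<in>A. u (f i))" "u 0 = 0"
    by (simp_all add: add scale diff sum zero)
qed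

text \<open>A kernel vector of the Hankel matrix is the coefficient vector of a polynomial
  \<open>p\<close> with \<open>u (p * monom 1 i) = 0\<close> for all \<open>i < n\<close>. Combining
  these equations with the conjugate coefficients of \<open>p\<close> yields
  \<open>u (p * map_poly cnj p) = 0\<close>.\<close>

lemma quasi_definite_if_anisotropic:
  assumes lin: "linear_functional u"
    and aniso: "\<And>p. u (p * map_poly cnj p) = 0 \<Longrightarrow> p = 0"
  shows "quasi_definite u"
  unfolding quasi_definite_def
proof (intro conjI allI impI lin notI)
  fix n :: nat
  assume "Determinant.det (hankel_mat u n) = 0"
  moreover have H: "hankel_mat u n \<in> carrier_mat n n"
    by (simp add: hankel_mat_def)
  ultimately obtain v where v: "v \<in> carrier_vec n" "v \<noteq> 0\<^sub>v n" "hankel_mat u n *\<^sub>v v = 0\<^sub>v n"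
    using det_0_iff_vec_prod_zero_field by blast
  define p where "p = (\<Sum>j<n. monom (v $ j) j)"
  have coeff_p: "poly.coeff p j = (if j < n then v $ j else 0)" for j
    by (auto simp: p_def coeff_sum)
  have orth: "u (p * monom 1 i) = 0" if "i < n" for i
  proof -
    have "p * monom 1 i = (\<Sum>j<n. Polynomial.smult (v $ j) (monom 1 (i + j)))"
      by (simp add: p_def sum_distrib_right mult_monom smult_monom add.commute)
    then have "u (p * monom 1 i) = (\<Sum>j<n. v $ j * u (monom 1 (i + j)))"
      by (simp add: linear_functional_simps[OF lin])
    also have "\<dots> = (hankel_mat u n *\<^sub>v v) $ i"
      using that v(1) by (auto simp: hankel_mat_def scalar_prod_def lessThan_atLeast0 mult.commute
          intro!: sum.cong)
    finally show ?thesis using v(3) that by simp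
  qed
  have "map_poly cnj p = (\<Sum>i<n. Polynomial.smult (cnj (v $ i)) (monom 1 i))"
    by (rule poly_eqI) (auto simp: coeff_map_poly coeff_p coeff_sum smult_monom)
  then have "u (p * map_poly cnj p) = (\<Sum>i<n. cnj (v $ i) * u (p * monom 1 i))"
    by (simp add: sum_distrib_left linear_functional_simps[OF lin])
  then have "p = 0"
    using orth by (intro aniso) simp
  then have "v = 0\<^sub>v n"
    using v(1) coeff_p by (intro eq_vecI) (auto, metis coeff_0)
  then show False using v(2) by simp
qed

section \<open>Integrability of the weight\<close>

text \<open>The substitution \<open>t = (1 + x) / 2\<close> gives
  \<open>1 - x^2 = 4 * t * (1 - t)\<close>, so up to constants this is the Beta integral with both
  parameters equal to \<open>a + 1 > 0\<close>.\<close>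

lemma set_integrable_one_minus_square_powr:
  fixes a :: real
  assumes "a > -1"
  shows "set_integrable lborel {-1..1} (\<lambda>x. (1 - x\<^sup>2) powr a)"
proof -
  have "set_integrable lborel {0..1} (\<lambda>t. t powr (a + 1 - 1) * (1 - t) powr (a + 1 - 1))"
    using assms by (intro integrable_Beta) auto
  then have "integrable lborel (\<lambda>x. indicator {0..1::real} (1/2 + 1/2 * x) *\<^sub>R
      ((1/2 + 1/2 * x) powr a * (1 - (1/2 + 1/2 * x)) powr a))"
    unfolding set_integrable_def by (intro lborel_integrable_real_affine) auto
  then have "integrable lborel (\<lambda>x. 4 powr a * (indicator {0..1::real} (1/2 + 1/2 * x) *\<^sub>R
      ((1/2 + 1/2 * x) powr a * (1 - (1/2 + 1/2 * x)) powr a)))"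
    by (rule integrable_mult_right)
  also have "(\<lambda>x. 4 powr a * (indicator {0..1::real} (1/2 + 1/2 * x) *\<^sub>R
      ((1/2 + 1/2 * x) powr a * (1 - (1/2 + 1/2 * x)) powr a))) =
    (\<lambda>x. indicator {-1..1} x *\<^sub>R (1 - x\<^sup>2) powr a)"
  proof
    fix x :: real
    show "4 powr a * (indicator {0..1::real} (1/2 + 1/2 * x) *\<^sub>R
      ((1/2 + 1/2 * x) powr a * (1 - (1/2 + 1/2 * x)) powr a)) =
      indicator {-1..1} x *\<^sub>R (1 - x\<^sup>2) powr a"
    proof (cases "x \<in> {-1..1}")
      case True
      then have "4 powr a * ((1/2 + 1/2 * x) powr a * (1 - (1/2 + 1/2 * x)) powr a) =
          (4 * ((1/2 + 1/2 * x) * (1 - (1/2 + 1/2 * x)))) powr a"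
        by (subst powr_mult | simp)+
      also have "4 * ((1/2 + 1/2 * x) * (1 - (1/2 + 1/2 * x))) = 1 - x\<^sup>2"
        by (simp add: field_simps power2_eq_square)
      finally show ?thesis using True by (simp add: indicator_def)
    qed (auto simp: indicator_def)
  qed
  finally show ?thesis unfolding set_integrable_def .
qed

lemma borel_measurable_gegenbauer_weight [measurable]: "gegenbauer_weight a z \<in> borel_measurable borel"
  unfolding gegenbauer_weight_def by measurable

text \<open>On the compact interval the polynomial is bounded, and the exponential is at most 1
  because \<open>z \<ge> 0\<close>; a multiple of \<open>(1 - x^2) powr a\<close> therefore
  dominates.\<close>

lemma set_integrable_poly_gegenbauer_weight:
  assumes "a > -1" "z \<ge> 0"
  shows "set_integrable lborel {-1..1}
    (\<lambda>x. poly p (complex_of_real x) * complex_of_real (gegenbauer_weight a z x))"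
proof -
  have "continuous_on {-1..1} (\<lambda>x. poly p (complex_of_real x))"
    by (intro continuous_intros)
  then have "bounded ((\<lambda>x. poly p (complex_of_real x)) ` {-1..1})"
    by (intro compact_imp_bounded compact_continuous_image) auto
  then obtain C where C: "\<And>x. x \<in> {-1..1} \<Longrightarrow> norm (poly p (complex_of_real x)) \<le> C"
    unfolding bounded_iff by blast
  have meas: "(\<lambda>x. poly p (complex_of_real x)) \<in> borel_measurable borel"
    by (intro borel_measurable_continuous_onI continuous_intros)
  show ?thesis
  proof (rule set_integrable_bound)
    show "set_integrable lborel {-1..1} (\<lambda>x. C * (1 - x\<^sup>2) powr a)"
      using set_integrable_one_minus_square_powr[OF assms(1)] by simp
    show "set_borel_measurable lborel {-1..1}
        (\<lambda>x. poly p (complex_of_real x) * complex_of_real (gegenbauer_weight a z x))"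
      unfolding set_borel_measurable_def using meas by measurable
    have "norm (poly p (complex_of_real x) * complex_of_real (gegenbauer_weight a z x))
        \<le> norm (C * (1 - x\<^sup>2) powr a)" if x: "x \<in> {-1..1}" for x
    proof -
      have "exp (- z * x\<^sup>2) \<le> 1"
        using assms(2) by (simp add: zero_le_mult_iff)
      then have "gegenbauer_weight a z x \<le> (1 - x\<^sup>2) powr a"
        unfolding gegenbauer_weight_def by (intro mult_left_le) auto
      moreover have "0 \<le> gegenbauer_weight a z x" by (simp add: gegenbauer_weight_def)
      moreover have "0 \<le> C" using C[OF x] norm_ge_zero order_trans by blast
      ultimately show ?thesis
        using C[OF x] by (simp add: norm_mult mult_mono)
    qed
    then show "AE x in lborel. x \<in> {-1..1} \<longrightarrow>
        norm (poly p (complex_of_real x) * complex_of_real (gegenbauer_weight a z x))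
        \<le> norm (C * (1 - x\<^sup>2) powr a)"
      by blast
  qed
qed

section \<open>Linearity and positivity of the functional\<close>

lemma linear_functional_gegenbauer_functional:
  assumes "a > -1" "z \<ge> 0"
  shows "linear_functional (gegenbauer_functional a z)"
  unfolding linear_functional_def
proof unfold_locales
  fix p q :: "complex poly" and c :: complex
  note int = set_integrable_poly_gegenbauer_weight[OF assms]
  show "gegenbauer_functional a z (p + q) = gegenbauer_functional a z p + gegenbauer_functional a z q"
    unfolding gegenbauer_functional_def
    by (simp add: ring_distribs set_integral_add(2)[OF int int])
  show "gegenbauer_functional a z (Polynomial.smult c p) = c * gegenbauer_functional a z p"
    unfolding gegenbauer_functional_def by (simp add: mult.assoc)
qed (simp_all add: algebra_simps smult_add_right smult_add_left)

text \<open>At real points \<open>map_poly cnj p\<close> takes the conjugate values of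
  \<open>p\<close>, so the integrand is \<open>|p|^2\<close> times the weight. A zero integral makes
  it vanish almost everywhere, but inside the interval it is zero only at the finitely many roots of
  \<open>p\<close>.\<close>

lemma gegenbauer_functional_anisotropic:
  assumes "a > -1" "z \<ge> 0" "gegenbauer_functional a z (p * map_poly cnj p) = 0"
  shows "p = 0"
proof (rule ccontr)
  assume "p \<noteq> 0"
  define f where "f x = (norm (poly p (complex_of_real x)))\<^sup>2 * gegenbauer_weight a z x" for x
  have eq: "poly (p * map_poly cnj p) (complex_of_real x) * complex_of_real (gegenbauer_weight a z x)
      = complex_of_real (f x)" for x
    by (simp add: f_def complex_norm_square[symmetric])
  have "set_integrable lborel {-1..1} (\<lambda>x. complex_of_real (f x))"
    using set_integrable_poly_gegenbauer_weight[OF assms(1,2), of "p * map_poly cnj p"] unfolding eq .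
  then have int: "set_integrable lborel {-1..1} f"
    by (simp add: set_integrable_def complex_of_real_integrable_eq[symmetric] scaleR_conv_of_real)
  have "(LINT x:{-1..1}|lborel. complex_of_real (f x)) = 0"
    using assms(3) unfolding gegenbauer_functional_def eq .
  then have "(LINT x:{-1..1}|lborel. f x) = 0"
    by (simp add: set_integral_complex_of_real)
  then have "AE x in lborel. indicator {-1..1} x *\<^sub>R f x = 0"
    using int unfolding set_lebesgue_integral_def set_integrable_def
    by (subst (asm) integral_nonneg_eq_0_iff_AE) (auto simp: f_def gegenbauer_weight_def)
  moreover have "finite {x::real. poly p (complex_of_real x) = 0}"
    using finite_vimageI[OF poly_roots_finite[OF \<open>p \<noteq> 0\<close>], of complex_of_real]
    by (simp add: vimage_def inj_of_real)
  then have "AE x in lborel. x \<notin> {x::real. poly p (complex_of_real x) = 0}"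
    by (intro AE_not_in finite_imp_null_set_lborel)
  ultimately have "AE x in lborel. x \<notin> {-1<..<1::real}"
  proof eventually_elim
    case (elim x)
    have "f x \<noteq> 0" if "x \<in> {-1<..<1}"
    proof -
      have "x\<^sup>2 < 1" using that by (simp add: abs_square_less_1 abs_less_iff)
      then show ?thesis using elim(2) by (simp add: f_def gegenbauer_weight_def)
    qed
    then show ?case using elim(1) by (auto simp: indicator_def)
  qed
  then have "{-1<..<1::real} \<in> null_sets lborel"
    by (subst (asm) AE_iff_null_sets[symmetric]) auto
  then show False by auto
qed

section \<open>Integration by parts and the Pearson equation\<close>

text \<open>The derivative is prescribed only in the open interval, since the weight is badly
  behaved at the end points: it is unbounded near them for \<open>a < 0\<close> and jumps to 0 there
  for \<open>a = 0\<close>.\<close>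

lemma gegenbauer_functional_FTC:
  assumes "a > -1" "z \<ge> 0" "continuous_on {-1..1} F"
    and "\<And>x. x \<in> {-1<..<1} \<Longrightarrow> (F has_vector_derivative
      poly p (complex_of_real x) * complex_of_real (gegenbauer_weight a z x)) (at x)"
  shows "gegenbauer_functional a z p = F 1 - F (- 1)"
proof -
  have "((\<lambda>x. poly p (complex_of_real x) * complex_of_real (gegenbauer_weight a z x))
      has_integral (F 1 - F (- 1))) {-1..1}"
    using assms(3,4) by (intro fundamental_theorem_of_calculus_interior) auto
  then show ?thesis
    unfolding gegenbauer_functional_def
    by (simp add: set_borel_integral_eq_integral(2)[OF set_integrable_poly_gegenbauer_weight[OF assms(1,2)]]
        integral_unique)
qed

lemma pearson_eq_iff:
  "pearson_eq u \<phi> \<psi> \<longleftrightarrow> (\<forall>p. u (\<phi> * pderiv p) = u (\<psi> * p))"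
  by (auto simp: pearson_eq_def functional_deriv_def poly_times_def fun_eq_iff)

lemma gegenbauer_functional_pearson:
  assumes "a > -1" "z \<ge> 0"
  shows "pearson_eq (gegenbauer_functional a z) [:1, 0, -1:]
    [:0, complex_of_real (2 * z + 2 * a + 2), 0, - complex_of_real (2 * z):]"
    (is "pearson_eq _ ?\<phi> ?\<psi>")
  unfolding pearson_eq_iff
proof
  fix p :: "complex poly"
  let ?s = "gegenbauer_functional a z"
  \<comment> \<open>Raising the exponent by one multiplies the weight by \<open>1 - x^2\<close>, so
    \<open>F\<close> is \<open>?\<phi> * p\<close> times the original weight.\<close>
  define F where "F x = poly p (complex_of_real x) * complex_of_real (gegenbauer_weight (a + 1) z x)" for x
  have "?s (?\<phi> * pderiv p - ?\<psi> * p) = F 1 - F (- 1)"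
  proof (rule gegenbauer_functional_FTC[OF assms])
    \<comment> \<open>The base \<open>1 - x^2\<close> is 0 at the end points; continuity there rests
      on \<open>a + 1 > 0\<close>.\<close>
    show "continuous_on {-1..1} F"
      unfolding F_def gegenbauer_weight_def using assms
      by (intro continuous_intros continuous_on_powr') (auto simp: abs_square_le_1)
    fix x :: real
    assume "x \<in> {-1<..<1}"
    then have pos: "0 < 1 - x\<^sup>2" by (simp add: abs_square_less_1 abs_less_iff)
    have "(gegenbauer_weight (a + 1) z has_real_derivative
        - (2 * z + 2 * a + 2 - 2 * z * x\<^sup>2) * x * gegenbauer_weight a z x) (at x)"
    proof -
      have "((\<lambda>x. (1 - x\<^sup>2) powr (a + 1)) has_real_derivative
          ((a + 1) * (1 - x\<^sup>2) powr (a + 1 - 1)) * (- 2 * x)) (at x)"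
        using pos by (intro DERIV_chain2[OF has_real_derivative_powr])
          (auto intro!: derivative_eq_intros)
      moreover have "((\<lambda>x. exp (- z * x\<^sup>2)) has_real_derivative
          - 2 * z * x * exp (- z * x\<^sup>2)) (at x)"
        by (auto intro!: derivative_eq_intros)
      ultimately have "((\<lambda>x. (1 - x\<^sup>2) powr (a + 1) * exp (- z * x\<^sup>2)) has_real_derivative
          ((a + 1) * (1 - x\<^sup>2) powr (a + 1 - 1)) * (- 2 * x) * exp (- z * x\<^sup>2) +
          - 2 * z * x * exp (- z * x\<^sup>2) * (1 - x\<^sup>2) powr (a + 1)) (at x)"
        by (rule DERIV_mult)
      moreover have "(1 - x\<^sup>2) powr (a + 1) = (1 - x\<^sup>2) * (1 - x\<^sup>2) powr a"
        using pos by (simp add: powr_add)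
      then have "((a + 1) * (1 - x\<^sup>2) powr (a + 1 - 1)) * (- 2 * x) * exp (- z * x\<^sup>2) +
          - 2 * z * x * exp (- z * x\<^sup>2) * (1 - x\<^sup>2) powr (a + 1) =
          - (2 * z + 2 * a + 2 - 2 * z * x\<^sup>2) * x * gegenbauer_weight a z x"
        by (simp only: gegenbauer_weight_def) (simp add: algebra_simps)
      ultimately show ?thesis
        unfolding gegenbauer_weight_def by (simp only:)
    qed
    then have w_deriv: "((\<lambda>x. complex_of_real (gegenbauer_weight (a + 1) z x)) has_vector_derivative
        complex_of_real (- (2 * z + 2 * a + 2 - 2 * z * x\<^sup>2) * x * gegenbauer_weight a z x)) (at x)"
      by (intro has_vector_derivative_of_real) (simp add: has_real_derivative_iff_has_vector_derivative)
    have "((\<lambda>x. poly p (complex_of_real x)) has_vector_derivative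
        poly (pderiv p) (complex_of_real x)) (at x)"
      by (rule has_vector_derivative_real_field) (rule poly_DERIV)
    from this w_deriv have "(F has_vector_derivative poly p (complex_of_real x) *
        complex_of_real (- (2 * z + 2 * a + 2 - 2 * z * x\<^sup>2) * x * gegenbauer_weight a z x) +
        poly (pderiv p) (complex_of_real x) * complex_of_real (gegenbauer_weight (a + 1) z x)) (at x)"
      unfolding F_def by (rule has_vector_derivative_mult)
    also have "gegenbauer_weight (a + 1) z x = (1 - x\<^sup>2) * gegenbauer_weight a z x"
      using pos by (simp add: gegenbauer_weight_def powr_add)
    finally show "(F has_vector_derivative poly (?\<phi> * pderiv p - ?\<psi> * p) (complex_of_real x) *
        complex_of_real (gegenbauer_weight a z x)) (at x)"
      by (simp add: algebra_simps power2_eq_square)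
  qed
  also have "F 1 - F (- 1) = 0"
    by (simp add: F_def gegenbauer_weight_def)
  finally show "?s (?\<phi> * pderiv p) = ?s (?\<psi> * p)"
    by (simp only: linear_functional_simps(3)[OF linear_functional_gegenbauer_functional[OF assms]]
        right_minus_eq)
qed

section \<open>Comparison of Pearson pairs and the class\<close>

text \<open>Testing the first equation with \<open>\<phi>' * p\<close> and the second with
  \<open>\<phi> * p\<close> makes the terms containing \<open>pderiv p\<close> cancel. What remains
  is \<open>u (q * p) = 0\<close> for every \<open>p\<close>, in particular for the conjugate of
  \<open>q\<close>.\<close>

lemma pearson_eq_cross:
  assumes lin: "linear_functional u"
    and aniso: "\<And>p. u (p * map_poly cnj p) = 0 \<Longrightarrow> p = 0"
    and "pearson_eq u \<phi> \<psi>" "pearson_eq u \<phi>' \<psi>'"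
  shows "\<phi> * (pderiv \<phi>' + \<psi>') = \<phi>' * (pderiv \<phi> + \<psi>)"
proof -
  define q where "q = \<phi> * (pderiv \<phi>' + \<psi>') - \<phi>' * (pderiv \<phi> + \<psi>)"
  have "u (q * p) = 0" for p
  proof -
    have "q * p = (\<phi> * pderiv (\<phi>' * p) - \<psi> * (\<phi>' * p)) - (\<phi>' * pderiv (\<phi> * p) - \<psi>' * (\<phi> * p))"
      by (simp add: q_def pderiv_mult algebra_simps)
    then show ?thesis
      using assms(3,4) by (simp add: pearson_eq_iff linear_functional_simps[OF lin])
  qed
  then have "q = 0" by (intro aniso)
  then show ?thesis by (simp add: q_def)
qed

text \<open>By \<open>eq\<close>, the weighted integrand of
  \<open>\<phi> * pderiv p - \<psi> * p\<close> is the derivative of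
  \<open>\<phi> * p * exp (- z * x^2)\<close> inside the interval. The Pearson equation thus equates
  the two boundary values, and the common factor \<open>exp (- z)\<close> cancels.\<close>

lemma pearson_zero_weight_boundary:
  assumes "z \<ge> 0" and pearson: "pearson_eq (gegenbauer_functional 0 z) \<phi> \<psi>"
    and eq: "pderiv \<phi> + \<psi> = [:0, complex_of_real (2 * z):] * \<phi>"
  shows "poly \<phi> 1 * poly p 1 = poly \<phi> (- 1) * poly p (- 1)"
proof -
  let ?s = "gegenbauer_functional 0 z"
  define F where "F x = poly (\<phi> * p) (complex_of_real x) * complex_of_real (exp (- z * x\<^sup>2))" for x
  have lin: "linear_functional ?s"
    using assms(1) by (intro linear_functional_gegenbauer_functional) auto
  have "?s (pderiv (\<phi> * p) - [:0, complex_of_real (2 * z):] * (\<phi> * p)) = F 1 - F (- 1)"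
  proof (rule gegenbauer_functional_FTC)
    show "continuous_on {-1..1} F"
      unfolding F_def by (intro continuous_intros)
    fix x :: real
    assume "x \<in> {-1<..<1}"
    then have "x\<^sup>2 < 1" by (simp add: abs_square_less_1 abs_less_iff)
    \<comment> \<open>This fails at \<open>x = \<plusminus>1\<close>, where \<open>0 powr 0 = 0\<close>.\<close>
    then have w: "gegenbauer_weight 0 z x = exp (- z * x\<^sup>2)" by (simp add: gegenbauer_weight_def)
    have "((\<lambda>x. exp (- z * x\<^sup>2)) has_real_derivative - 2 * z * x * exp (- z * x\<^sup>2)) (at x)"
      by (auto intro!: derivative_eq_intros)
    then have w_deriv: "((\<lambda>x. complex_of_real (exp (- z * x\<^sup>2))) has_vector_derivative
        complex_of_real (- 2 * z * x * exp (- z * x\<^sup>2))) (at x)"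
      by (intro has_vector_derivative_of_real) (simp add: has_real_derivative_iff_has_vector_derivative)
    have "((\<lambda>x. poly (\<phi> * p) (complex_of_real x)) has_vector_derivative
        poly (pderiv (\<phi> * p)) (complex_of_real x)) (at x)"
      by (rule has_vector_derivative_real_field) (rule poly_DERIV)
    from this w_deriv have "(F has_vector_derivative poly (\<phi> * p) (complex_of_real x) *
        complex_of_real (- 2 * z * x * exp (- z * x\<^sup>2)) +
        poly (pderiv (\<phi> * p)) (complex_of_real x) * complex_of_real (exp (- z * x\<^sup>2))) (at x)"
      unfolding F_def by (rule has_vector_derivative_mult)
    then show "(F has_vector_derivative
        poly (pderiv (\<phi> * p) - [:0, complex_of_real (2 * z):] * (\<phi> * p)) (complex_of_real x) *
        complex_of_real (gegenbauer_weight 0 z x)) (at x)"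
      unfolding w by (simp add: algebra_simps)
  qed (use assms(1) in auto)
  also have "pderiv (\<phi> * p) - [:0, complex_of_real (2 * z):] * (\<phi> * p) = \<phi> * pderiv p - \<psi> * p"
  proof -
    have "[:0, complex_of_real (2 * z):] * (\<phi> * p) = (pderiv \<phi> + \<psi>) * p"
      by (simp only: eq mult.assoc)
    then show ?thesis by (simp add: pderiv_mult algebra_simps)
  qed
  also have "?s \<dots> = 0"
    using pearson by (simp add: pearson_eq_iff linear_functional_simps[OF lin])
  finally show ?thesis by (simp add: F_def)
qed

lemma gegenbauer_pearson_degree:
  assumes "a > -1" "z > 0" "\<phi> \<noteq> 0" and pearson: "pearson_eq (gegenbauer_functional a z) \<phi> \<psi>"
  shows "degree \<psi> \<ge> 3"
proof -
  let ?s = "gegenbauer_functional a z"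
  define \<phi>0 where "\<phi>0 = [:1, 0, -1 :: complex:]"
  \<comment> \<open>With \<open>w\<close> the weight, \<open>\<omega> = - \<phi>0 * w' / w\<close>
    inside the interval. The \<open>2 * a + 2\<close> of the known \<open>\<psi>\<close> drops to
    \<open>2 * a\<close> because \<open>pderiv \<phi>0\<close> is \<open>- 2 * x\<close>.\<close>
  define \<omega> where "\<omega> = [:0, complex_of_real (2 * z + 2 * a), 0, - complex_of_real (2 * z):]"
  have "\<phi>0 * (pderiv \<phi> + \<psi>) =
      \<phi> * (pderiv \<phi>0 + [:0, complex_of_real (2 * z + 2 * a + 2), 0, - complex_of_real (2 * z):])"
    unfolding \<phi>0_def using assms
    by (intro pearson_eq_cross[where u = ?s] linear_functional_gegenbauer_functional
        gegenbauer_functional_pearson) (auto intro: gegenbauer_functional_anisotropic[OF _ less_imp_le])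
  also have "pderiv \<phi>0 + [:0, complex_of_real (2 * z + 2 * a + 2), 0, - complex_of_real (2 * z):] = \<omega>"
    by (simp add: \<phi>0_def \<omega>_def pderiv_pCons)
  finally have cross: "\<phi>0 * (pderiv \<phi> + \<psi>) = \<phi> * \<omega>" .
  have root: "poly \<phi> 1 = 0 \<and> poly \<phi> (- 1) = 0"
  proof (cases "a = 0")
    case True
    have "\<omega> = \<phi>0 * [:0, complex_of_real (2 * z):]"
      by (simp add: True \<omega>_def \<phi>0_def)
    with cross have "\<phi>0 * (pderiv \<phi> + \<psi>) = \<phi>0 * ([:0, complex_of_real (2 * z):] * \<phi>)"
      by (simp only: mult_ac)
    then have "pderiv \<phi> + \<psi> = [:0, complex_of_real (2 * z):] * \<phi>"
      by (subst (asm) mult_left_cancel) (auto simp: \<phi>0_def)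
    then have boundary: "poly \<phi> 1 * poly p 1 = poly \<phi> (- 1) * poly p (- 1)" for p
      using pearson assms(2) unfolding True by (intro pearson_zero_weight_boundary) auto
    \<comment> \<open>Each test polynomial vanishes at one end point and so isolates the value of
      \<open>\<phi>\<close> at the other.\<close>
    show ?thesis
      using boundary[of "[:1, 1:]"] boundary[of "[:-1, 1:]"] by simp
  next
    case False
    \<comment> \<open>At 1 and -1, \<open>\<phi>0\<close> vanishes whereas \<open>\<omega>\<close>
      takes the values \<open>2 * a\<close> and \<open>- 2 * a\<close>.\<close>
    have "poly \<phi> x * poly \<omega> x = poly \<phi>0 x * poly (pderiv \<phi> + \<psi>) x" for x
      by (simp only: poly_mult[symmetric] cross)
    from this[of 1] this[of "- 1"] show ?thesis
      using False by (simp add: \<omega>_def \<phi>0_def)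
  qed
  then have "[:-1, 1:] dvd \<phi>" by (simp add: poly_eq_0_iff_dvd)
  then obtain h where h: "\<phi> = [:-1, 1:] * h" by blast
  with root have "poly h (- 1) = 0" by simp
  then obtain k where k: "h = [:1, 1:] * k" by (auto simp: poly_eq_0_iff_dvd)
  \<comment> \<open>The sign compensates for \<open>(x - 1) * (x + 1)\<close> being
    \<open>- \<phi>0\<close>.\<close>
  define g where "g = - k"
  have \<phi>: "\<phi> = \<phi>0 * g"
    by (simp add: h k g_def \<phi>0_def)
  with \<open>\<phi> \<noteq> 0\<close> have "g \<noteq> 0" by auto
  have "\<phi>0 * (pderiv \<phi> + \<psi>) = \<phi>0 * (g * \<omega>)"
    using cross \<phi> by (simp only: mult_ac)
  then have "pderiv \<phi> + \<psi> = g * \<omega>"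
    by (subst (asm) mult_left_cancel) (auto simp: \<phi>0_def)
  then have \<psi>: "g * \<omega> - pderiv \<phi> = \<psi>" by (simp add: algebra_simps)
  \<comment> \<open>The leading coefficient is \<open>- 2 * z\<close>, nonzero because
    \<open>z > 0\<close>.\<close>
  have "degree \<omega> = 3" using assms(2) by (simp add: \<omega>_def)
  then have "degree (g * \<omega>) = degree g + 3"
    using \<open>g \<noteq> 0\<close> by (subst degree_mult_eq) auto
  moreover have "degree \<phi> = degree g + 2"
    unfolding \<phi> using \<open>g \<noteq> 0\<close> by (subst degree_mult_eq) (auto simp: \<phi>0_def)
  then have "degree (pderiv \<phi>) = degree g + 1"
    by (simp add: degree_pderiv)
  ultimately have "degree (g * \<omega> - pderiv \<phi>) = degree g + 3"
    by (simp add: degree_add_eq_left diff_conv_add_uminus del: add_uminus_conv_diff)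
  then show ?thesis by (simp add: \<psi>)
qed

theorem theorem3p1:
  fixes lam z :: real and s :: "complex poly \<Rightarrow> complex"
  assumes "lam > - 1 / 2" and "z > 0"
    and "\<And>p. s p = (LINT x:{-1..1}|lborel.
           poly p (complex_of_real x) *
           complex_of_real ((1 - x\<^sup>2) powr (lam - 1 / 2) * exp (- z * x\<^sup>2)))"
  shows "semiclassical s \<and> semiclassical_class s = 2 \<and>
    pearson_eq s [:1, 0, -1:]
      [:0, complex_of_real (2 * z + 2 * lam + 1), 0, - complex_of_real (2 * z):]"
proof -
  define a where "a = lam - 1 / 2"
  have a: "a > -1" using assms(1) by (simp add: a_def)
  have s: "s = gegenbauer_functional a z"
    by (rule ext) (simp add: assms(3) gegenbauer_functional_def gegenbauer_weight_def a_def)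
  let ?\<phi> = "[:1, 0, -1 :: complex:]"
  let ?\<psi> = "[:0, complex_of_real (2 * z + 2 * lam + 1), 0, - complex_of_real (2 * z):]"
  have pearson: "pearson_eq s ?\<phi> ?\<psi>"
    using gegenbauer_functional_pearson[OF a, of z] assms(2) by (simp add: s a_def algebra_simps)
  have pair: "pearson_pair s ?\<phi> ?\<psi>"
    using pearson assms(2) by (simp add: pearson_pair_def)
  have "quasi_definite s"
    unfolding s using a assms(2)
    by (intro quasi_definite_if_anisotropic linear_functional_gegenbauer_functional)
      (auto intro: gegenbauer_functional_anisotropic[OF _ less_imp_le])
  moreover have "semiclassical_class s = 2"
    unfolding semiclassical_class_def
  proof (rule Least_equality)
    \<comment> \<open>The degrees are 2 and 3, so the maximum is \<open>max 0 2\<close>.\<close>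
    have "2 = max (int (degree ?\<phi>) - 2) (int (degree ?\<psi>) - 1)"
      using assms(2) by simp
    with pair show "\<exists>\<phi> \<psi>. pearson_pair s \<phi> \<psi> \<and>
        2 = max (int (degree \<phi>) - 2) (int (degree \<psi>) - 1)"
      by blast
  next
    fix m
    assume "\<exists>\<phi> \<psi>. pearson_pair s \<phi> \<psi> \<and> m = max (int (degree \<phi>) - 2) (int (degree \<psi>) - 1)"
    then obtain \<phi> \<psi> where "pearson_pair s \<phi> \<psi>"
      and m: "m = max (int (degree \<phi>) - 2) (int (degree \<psi>) - 1)" by blast
    then have "degree \<psi> \<ge> 3"
      using a assms(2) unfolding s pearson_pair_def by (intro gegenbauer_pearson_degree[of a z]) auto
    then show "2 \<le> m" by (simp add: m)
  qed
  ultimately show ?thesis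
    using pearson pair unfolding semiclassical_def by blast
qed

end
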